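(* Let $k$ be an integer. Then the generalized Bernoulli numbers $B_n^{(m)}$ and the Bernoulli numbers $B_n$ satisfy, for all integers $n\ge 0$, $$B_{n+1}^{(k)}=k\sum_{i=0}^{n}\binom{n}{i}B_{i+1}B_{n-i}^{(k-1)}$$ and $$B_{n+1}^{(-k)}=k\sum_{i=0}^{n}\binom{n}{i}\frac{1}{i+2}B_{n-i}^{(-(k-1))}.$$
   Context: For any integer $m$, the generalized Bernoulli numbers $B_n^{(m)}$ are defined by the formal power series identity $\left(1+\sum_{n\geq 1}\frac{1}{(n+1)!}X^{n}\right)^{-m}=1+\sum_{n\geq 1}\frac{1}{n!}B_{n}^{(m)}X^{n}$, with $B_0^{(m)}=1$; the Bernoulli numbers are $B_n=B_n^{(1)}$. *)

theory Defs
  imports "HOL-Computational_Algebra.Formal_Power_Series"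
begin

text \<open>The series \<open>1 + (\<Sum>n\<ge>1. X^n / (n+1)!)\<close>; the constant term \<open>1 / 1!\<close> is the case \<open>n = 0\<close>.\<close>

definition bernoulli_base :: "rat fps" where
  "bernoulli_base = Abs_fps (\<lambda>n. 1 / fact (n + 1))"

text \<open>
  \<open>gen_bernoulli m n\<close> is \<open>B_n^{(m)}\<close>. The constant term of \<open>bernoulli_base\<close> is \<open>1\<close>, so it is a unit
  in \<open>rat fps\<close> and \<open>inverse\<close>, through which \<open>powi\<close> treats negative exponents, is its true inverse.
  The defining identity and \<open>B_0^{(m)} = 1\<close> are confirmed below.
\<close>

definition gen_bernoulli :: "int \<Rightarrow> nat \<Rightarrow> rat" where
  "gen_bernoulli m n = fact n * fps_nth (bernoulli_base powi (- m)) n"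

definition bernoulli :: "nat \<Rightarrow> rat" where
  "bernoulli n = gen_bernoulli 1 n"

lemma bernoulli_base_inverse: "bernoulli_base * inverse bernoulli_base = 1"
  by (simp add: bernoulli_base_def inverse_mult_eq_1')

lemma gen_bernoulli_0: "gen_bernoulli m 0 = 1"
  by (simp add: gen_bernoulli_def power_int_def bernoulli_base_def fps_nth_power_0)

lemma gen_bernoulli_egf:
  "bernoulli_base powi (- m) = Abs_fps (\<lambda>n. gen_bernoulli m n / fact n)"
  by (simp add: fps_eq_iff gen_bernoulli_def)

end

theory Submission
  imports Defs
begin

text \<open>
  Both identities are the chain rule \<open>(F^k)' = k F' F^(k-1)\<close>, read off coefficient by coefficient.
  Let \<open>F\<close> be an exponential generating function with invertible constant term. Differentiation
  shifts the coefficients of exponential generating functions, and multiplication convolves them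
  with binomial weights, so the chain rule becomes a recurrence for the coefficients of \<open>F^k\<close>
  (\<open>egf_coeff_power_int_Suc\<close>). The base series \<open>A = (exp X - 1) / X\<close> is the exponential generating
  function of \<open>1 / (n + 1)\<close>, and its inverse is that of the Bernoulli numbers. Taking \<open>F = 1 / A\<close>
  gives the recurrence for the upper index \<open>k\<close>, and \<open>F = A\<close> the one for \<open>-k\<close>.
\<close>

definition egf_coeff :: "'a::field_char_0 fps \<Rightarrow> nat \<Rightarrow> 'a" where
  "egf_coeff F n = fact n * fps_nth F n"

lemma egf_coeff_deriv: "egf_coeff (fps_deriv F) n = egf_coeff F (Suc n)"
  by (simp add: egf_coeff_def algebra_simps)

lemma egf_coeff_mult:
  "egf_coeff (F * G) n = (\<Sum>i=0..n. of_nat (n choose i) * egf_coeff F i * egf_coeff G (n - i))"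
proof -
  have "fact n * (fps_nth F i * fps_nth G (n - i))
      = of_nat (n choose i) * egf_coeff F i * egf_coeff G (n - i)" if "i \<in> {0..n}" for i
    using that by (simp add: egf_coeff_def binomial_fact field_simps)
  then show ?thesis
    unfolding egf_coeff_def[of "F * G"] fps_mult_nth sum_distrib_left by (rule sum.cong[OF refl])
qed

text \<open>
  Formal power series do not form a division ring, so a negative power has its usual meaning only
  for a series with nonzero constant term. For exponents \<open>k \<le> 0\<close> the claim is the power rule for
  the inverse series combined with \<open>(1 / F)' = - F' / F^2\<close>.
\<close>

lemma fps_deriv_power_int:
  fixes F :: "'a::field_char_0 fps"
  assumes "fps_nth F 0 \<noteq> 0"
  shows "fps_deriv (F powi k) = fps_const (of_int k) * (fps_deriv F * F powi (k - 1))"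
proof (cases "k > 0")
  case True
  then obtain j where "k = int j" "j > 0"
    by (metis pos_int_cases)
  moreover from this have "k - 1 = int (j - 1)"
    by simp
  ultimately show ?thesis
    by (simp only: power_int_of_nat fps_deriv_power of_int_of_nat_eq mult.assoc)
next
  case False
  then obtain j where k: "k = - int j"
    by (metis linorder_not_less nonpos_int_cases)
  have "fps_deriv (inverse F ^ j) = - (fps_const (of_nat j) * (fps_deriv F * inverse F ^ Suc j))"
  proof (cases j)
    case (Suc i)
    have "inverse F ^ Suc j = (inverse F)\<^sup>2 * inverse F ^ (j - 1)"
      by (simp add: Suc power2_eq_square)
    then show ?thesis
      by (simp only: fps_deriv_power fps_inverse_deriv[OF assms] mult.assoc
          mult_minus_left mult_minus_right)
  qed simp
  moreover have "nat (1 + int j) = Suc j"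
    by simp
  ultimately show ?thesis
    by (cases "j = 0") (simp_all add: k power_int_def fps_const_neg[symmetric] del: fps_const_neg)
qed

lemma power_int_inverse_fps:
  fixes F :: "'a::field fps"
  assumes "fps_nth F 0 \<noteq> 0"
  shows "inverse F powi k = F powi (- k)"
  using assms by (auto simp: power_int_def fps_inverse_idempotent)

text \<open>
  The index shift on the left is a derivative. The chain rule turns it into the product of \<open>F'\<close> and
  \<open>F^(k-1)\<close>, and the shift inside the sum comes from the factor \<open>F'\<close>.
\<close>

lemma egf_coeff_power_int_Suc:
  assumes "fps_nth F 0 \<noteq> 0"
  shows "egf_coeff (F powi k) (Suc n) = of_int k *
    (\<Sum>i=0..n. of_nat (n choose i) * egf_coeff F (Suc i) * egf_coeff (F powi (k - 1)) (n - i))"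
proof -
  have "egf_coeff (F powi k) (Suc n) = of_int k * egf_coeff (fps_deriv F * F powi (k - 1)) n"
    unfolding egf_coeff_deriv[symmetric] fps_deriv_power_int[OF assms]
    by (simp add: egf_coeff_def)
  then show ?thesis
    by (simp only: egf_coeff_mult egf_coeff_deriv)
qed

lemma bernoulli_base_nth_0: "fps_nth bernoulli_base 0 \<noteq> 0"
  by (simp add: bernoulli_base_def)

lemma gen_bernoulli_eq_egf_coeff: "gen_bernoulli m n = egf_coeff (bernoulli_base powi (- m)) n"
  by (simp add: gen_bernoulli_def egf_coeff_def)

lemma gen_bernoulli_eq_egf_coeff_inverse:
  "gen_bernoulli m n = egf_coeff (inverse bernoulli_base powi m) n"
  by (simp add: gen_bernoulli_eq_egf_coeff power_int_inverse_fps[OF bernoulli_base_nth_0])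

lemma bernoulli_eq_egf_coeff: "bernoulli n = egf_coeff (inverse bernoulli_base) n"
  by (simp add: bernoulli_def gen_bernoulli_eq_egf_coeff power_int_def)

lemma egf_coeff_bernoulli_base: "egf_coeff bernoulli_base n = 1 / of_nat (n + 1)"
  by (simp add: egf_coeff_def bernoulli_base_def)

theorem theorem2p11:
  fixes k :: int
  shows "(\<forall>n::nat. gen_bernoulli k (n + 1) =
            of_int k * (\<Sum>i=0..n. of_nat (n choose i) * bernoulli (i + 1) * gen_bernoulli (k - 1) (n - i)))
       \<and> (\<forall>n::nat. gen_bernoulli (- k) (n + 1) =
            of_int k * (\<Sum>i=0..n. of_nat (n choose i) * (1 / of_nat (i + 2)) * gen_bernoulli (- (k - 1)) (n - i)))"
proof (intro conjI allI)
  fix n :: nat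
  have "fps_nth (inverse bernoulli_base) 0 \<noteq> 0"
    using bernoulli_base_nth_0 by simp
  from egf_coeff_power_int_Suc[OF this]
  show "gen_bernoulli k (n + 1) =
      of_int k * (\<Sum>i=0..n. of_nat (n choose i) * bernoulli (i + 1) * gen_bernoulli (k - 1) (n - i))"
    by (simp only: gen_bernoulli_eq_egf_coeff_inverse bernoulli_eq_egf_coeff Suc_eq_plus1)
next
  fix n :: nat
  have "egf_coeff bernoulli_base (Suc i) = 1 / of_nat (i + 2)" for i
    by (simp add: egf_coeff_bernoulli_base)
  with egf_coeff_power_int_Suc[OF bernoulli_base_nth_0, of k n]
  show "gen_bernoulli (- k) (n + 1) =
      of_int k * (\<Sum>i=0..n. of_nat (n choose i) * (1 / of_nat (i + 2)) * gen_bernoulli (- (k - 1)) (n - i))"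
    by (simp only: gen_bernoulli_eq_egf_coeff minus_minus Suc_eq_plus1)
qed

end
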